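(* Two filiform Leibniz algebras $L(b_{0,0},b_{0,1},b_{1,1},b_{1,2},b_{1,4},b)$ and $L(b_{0,0}',b_{0,1}',b_{1,1}',b_{1,2}',b_{1,4}',b')$ from $CE(\mu_7)$ are isomorphic if and only if there exist $A_0,A_1,B_1\in\mathbb{C}$ such that $A_0B_1(A_0+A_1b)\neq0$ and the following equalities hold (where $B_2,B_3,B_4,B_5$ are the further coefficients of the change of basis described in the context): $$b_{0,0}'=\frac{A_0^2b_{0,0}+A_0A_1b_{0,1}+A_1^2b_{1,1}}{A_0^5B_1(A_0+A_1b)},$$ $$b_{0,1}'=\frac{A_0b_{0,1}+2A_1b_{1,1}}{A_0^5(A_0+A_1b)},$$ $$b_{1,1}'=\frac{B_1b_{1,1}}{A_0^5(A_0+A_1b)},$$ $$b_{1,2}'=\frac{B_1^2b_{1,2}+(2B_1B_3-B_2^2)b_{1,4}+(2B_2B_4-2B_1B_5-B_3^2)b}{2A_0^4B_1(A_0+A_1b)},$$ $$b_{1,4}'=\frac{-B_1b_{1,4}+(-2B_1B_3+B_2^2)b}{A_0^2B_1(A_0+A_1b)},$$ $$b'=\frac{B_1b}{A_0+A_1b}.$$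
   Context: A Leibniz algebra over $\mathbb{C}$ is a complex vector space with a bilinear bracket satisfying $[x,[y,z]]=[[x,y],z]-[[x,z],y]$. $CE(\mu_7)$ (one-dimensional Leibniz central extensions of the 7-dimensional naturally graded filiform Lie algebra $\mu_7$) is the class of the 8-dimensional complex Leibniz algebras $L(b_{0,0},b_{0,1},b_{1,1},b_{1,2},b_{1,4},b)$, with $b_{i,j}\in\mathbb{C}$ and $b\in\{0,1\}$, having a basis $e_0,\dots,e_7$ (called adapted) and brackets $[e_i,e_0]=e_{i+1}$ ($1\le i\le 6$), $[e_0,e_i]=-e_{i+1}$ ($2\le i\le 6$), $[e_0,e_0]=b_{0,0}e_7$, $[e_0,e_1]=-e_2+b_{0,1}e_7$, $[e_1,e_1]=b_{1,1}e_7$, $[e_1,e_2]=-[e_2,e_1]=b_{1,2}e_7$, $[e_1,e_4]=-[e_4,e_1]=b_{1,4}e_7$, $[e_2,e_3]=-[e_3,e_2]=-b_{1,4}e_7$, $[e_1,e_6]=-[e_6,e_1]=-b\,e_7$, $[e_2,e_5]=-[e_5,e_2]=b\,e_7$, $[e_3,e_4]=-[e_4,e_3]=-b\,e_7$, all other brackets of basis vectors being zero. The primed parameters are those of the second algebra. The numbers $A_i,B_j\in\mathbb{C}$ are the coefficients of a change of adapted basis of the form $e_0'=A_0e_0+A_1e_1$, $e_1'=B_1e_1+B_2e_2+B_3e_3+B_4e_4+B_5e_5$, $e_{i+1}'=[e_i',e_0']$ ($1\le i\le 6$). Isomorphic means isomorphic as Leibniz algebras.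
   Formalization: The printed equivalence is false (e.g. for L(0,1,0,0,1,0) and itself). Corrected: in b_{1,4}' the term -B_1 b_{1,4} becomes B_1^2 b_{1,4}, and in b_{1,2}' the factor 2 in the denominator is dropped. B_2,...,B_5 are existentially quantified. *)

theory Defs
  imports Complex_Main
begin

text \<open>Right Leibniz algebras over the complex numbers, of arbitrary dimension.\<close>

locale leibniz_algebra = vector_space scale
  for scale :: "complex \<Rightarrow> 'a::ab_group_add \<Rightarrow> 'a" +
  fixes bracket :: "'a \<Rightarrow> 'a \<Rightarrow> 'a"
  assumes linear_bracket_left: "Vector_Spaces.linear scale scale (\<lambda>x. bracket x y)"
    and linear_bracket_right: "Vector_Spaces.linear scale scale (\<lambda>y. bracket x y)"
    and leibniz_identity:
      "bracket x (bracket y z) = bracket (bracket x y) z - bracket (bracket x z) y"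

definition leibniz_isomorphic ::
  "(complex \<Rightarrow> 'a::ab_group_add \<Rightarrow> 'a) \<Rightarrow> ('a \<Rightarrow> 'a \<Rightarrow> 'a) \<Rightarrow>
   (complex \<Rightarrow> 'b::ab_group_add \<Rightarrow> 'b) \<Rightarrow> ('b \<Rightarrow> 'b \<Rightarrow> 'b) \<Rightarrow> bool" where
  "leibniz_isomorphic scale\<^sub>1 bracket\<^sub>1 scale\<^sub>2 bracket\<^sub>2 \<longleftrightarrow>
     (\<exists>f. Vector_Spaces.linear scale\<^sub>1 scale\<^sub>2 f \<and> bij f \<and>
          (\<forall>x y. f (bracket\<^sub>1 x y) = bracket\<^sub>2 (f x) (f y)))"

text \<open>The bracket of the i-th and the j-th vector of an adapted basis; only the indices
  from 0 to 7 are meaningful.\<close>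

definition mu7_table ::
  "(complex \<Rightarrow> 'a::ab_group_add \<Rightarrow> 'a) \<Rightarrow> (nat \<Rightarrow> 'a) \<Rightarrow>
   complex \<Rightarrow> complex \<Rightarrow> complex \<Rightarrow> complex \<Rightarrow> complex \<Rightarrow> complex \<Rightarrow> nat \<Rightarrow> nat \<Rightarrow> 'a" where
  "mu7_table scale e b00 b01 b11 b12 b14 b i j =
    (if 1 \<le> i \<and> i \<le> 6 \<and> j = 0 then e (i + 1)
     else if i = 0 \<and> 2 \<le> j \<and> j \<le> 6 then - e (j + 1)
     else if (i, j) = (0, 0) then scale b00 (e 7)
     else if (i, j) = (0, 1) then - e 2 + scale b01 (e 7)
     else if (i, j) = (1, 1) then scale b11 (e 7)
     else if (i, j) = (1, 2) then scale b12 (e 7)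
     else if (i, j) = (2, 1) then scale (- b12) (e 7)
     else if (i, j) = (1, 4) then scale b14 (e 7)
     else if (i, j) = (4, 1) then scale (- b14) (e 7)
     else if (i, j) = (2, 3) then scale (- b14) (e 7)
     else if (i, j) = (3, 2) then scale b14 (e 7)
     else if (i, j) = (1, 6) then scale (- b) (e 7)
     else if (i, j) = (6, 1) then scale b (e 7)
     else if (i, j) = (2, 5) then scale b (e 7)
     else if (i, j) = (5, 2) then scale (- b) (e 7)
     else if (i, j) = (3, 4) then scale (- b) (e 7)
     else if (i, j) = (4, 3) then scale b (e 7)
     else 0)"

definition adapted_basis ::
  "(complex \<Rightarrow> 'a::ab_group_add \<Rightarrow> 'a) \<Rightarrow> ('a \<Rightarrow> 'a \<Rightarrow> 'a) \<Rightarrow>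
   complex \<Rightarrow> complex \<Rightarrow> complex \<Rightarrow> complex \<Rightarrow> complex \<Rightarrow> complex \<Rightarrow> (nat \<Rightarrow> 'a) \<Rightarrow> bool" where
  "adapted_basis scale bracket b00 b01 b11 b12 b14 b e \<longleftrightarrow>
     inj_on e {0..7} \<and>
     \<not> module.dependent scale (e ` {0..7}) \<and>
     module.span scale (e ` {0..7}) = UNIV \<and>
     (\<forall>i\<in>{0..7}. \<forall>j\<in>{0..7}.
        bracket (e i) (e j) = mu7_table scale e b00 b01 b11 b12 b14 b i j)"

text \<open>\<open>CE_mu7 scale bracket b00 b01 b11 b12 b14 b\<close>: the Leibniz algebra with this bracket
  is (a copy of) \<open>L(b00, b01, b11, b12, b14, b)\<close>.\<close>

definition CE_mu7 ::
  "(complex \<Rightarrow> 'a::ab_group_add \<Rightarrow> 'a) \<Rightarrow> ('a \<Rightarrow> 'a \<Rightarrow> 'a) \<Rightarrow>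
   complex \<Rightarrow> complex \<Rightarrow> complex \<Rightarrow> complex \<Rightarrow> complex \<Rightarrow> complex \<Rightarrow> bool" where
  "CE_mu7 scale bracket b00 b01 b11 b12 b14 b \<longleftrightarrow>
     leibniz_algebra scale bracket \<and> b \<in> {0, 1} \<and>
     (\<exists>e. adapted_basis scale bracket b00 b01 b11 b12 b14 b e)"

end

theory Submission
  imports Defs
begin

text \<open>The two algebras are isomorphic iff the first one has an adapted basis \<open>u\<close> with the
  primed parameters. Such a basis is generated by \<open>u 0\<close> and \<open>u 1\<close> through
  \<open>u (i + 1) = [u i, u 0]\<close>. The relation for \<open>[u 1, u 2]\<close> forces \<open>u 1\<close> to have no \<open>e 0\<close>
  component. Write \<open>A0, A1\<close> for the first components of \<open>u 0\<close> and \<open>Bj\<close> for those of \<open>u 1\<close>. Then, for \<open>i \<ge> 1\<close> and modulo the central vector \<open>e 7\<close>, \<open>u i\<close> is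
  \<open>A0 ^ (i - 1)\<close> times the shift of \<open>u 1\<close> by \<open>i - 1\<close> places, and
  \<open>u 7 = A0 ^ 5 * B1 * (A0 + A1 * b) * e 7\<close>; the components of \<open>u 0\<close> along
  \<open>e 2, \<dots>, e 7\<close> do not influence the parameters. Comparing the coefficients of \<open>e 7\<close> in the
  multiplication table of \<open>u\<close> gives the formulas, and conversely they make the table hold. The
  resulting \<open>u\<close> is a basis because it is triangular with respect to \<open>e\<close>.\<close>

section \<open>The multiplication table and scalar identities\<close>

text \<open>Every table entry is a linear combination of the \<open>e n\<close>, so \<open>f\<close>
  passes through it. It is applied both to coordinate functionals and to isomorphisms.\<close>

lemma linear_mu7_table:
  assumes "Vector_Spaces.linear s1 s2 f"
  shows "f (mu7_table s1 e b00 b01 b11 b12 b14 b i j) =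
    mu7_table s2 (\<lambda>n. f (e n)) b00 b01 b11 b12 b14 b i j"
proof -
  interpret Vector_Spaces.linear s1 s2 f by fact
  show ?thesis
    unfolding mu7_table_def by (simp add: add neg diff scale)
qed

lemma sum_0_to_7:
  fixes f :: "nat \<Rightarrow> 'a::comm_monoid_add"
  shows "(\<Sum>i\<in>{0..7}. f i) = f 0 + f 1 + f 2 + f 3 + f 4 + f 5 + f 6 + f 7"
  by (simp add: eval_nat_numeral)

text \<open>Bilinear expansion of a bracket. Here \<open>e\<close> takes complex values because it
  will be one fixed coordinate of each basis vector, so a single identity yields every coordinate of
  a bracket.\<close>

lemma mu7_table_bilinear_sum:
  fixes x y e :: "nat \<Rightarrow> complex" and b00 b01 b11 b12 b14 b :: complex
  shows "(\<Sum>i\<in>{0..7}. x i * (\<Sum>j\<in>{0..7}. y j * mu7_table (*) e b00 b01 b11 b12 b14 b i j)) =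
    (x 1 * y 0 - x 0 * y 1) * e 2 + (x 2 * y 0 - x 0 * y 2) * e 3
    + (x 3 * y 0 - x 0 * y 3) * e 4 + (x 4 * y 0 - x 0 * y 4) * e 5
    + (x 5 * y 0 - x 0 * y 5) * e 6
    + (x 6 * y 0 - x 0 * y 6 + b00 * x 0 * y 0 + b01 * x 0 * y 1 + b11 * x 1 * y 1
       + b12 * (x 1 * y 2 - x 2 * y 1)
       + b14 * (x 1 * y 4 - x 4 * y 1 - x 2 * y 3 + x 3 * y 2)
       - b * (x 1 * y 6 - x 6 * y 1 - x 2 * y 5 + x 5 * y 2 + x 3 * y 4 - x 4 * y 3)) * e 7"
proof -
  \<comment> \<open>Summing the table row by row reduces the 64 products to eight linear forms in
    \<open>y\<close> before the final polynomial identity.\<close>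
  define row where "row i = (\<Sum>j\<in>{0..7}. y j * mu7_table (*) e b00 b01 b11 b12 b14 b i j)" for i
  have rows:
    "row 0 = (b00 * y 0 + b01 * y 1) * e 7
      - (y 1 * e 2 + y 2 * e 3 + y 3 * e 4 + y 4 * e 5 + y 5 * e 6 + y 6 * e 7)"
    "row 1 = y 0 * e 2 + (b11 * y 1 + b12 * y 2 + b14 * y 4 - b * y 6) * e 7"
    "row 2 = y 0 * e 3 + (b * y 5 - b12 * y 1 - b14 * y 3) * e 7"
    "row 3 = y 0 * e 4 + (b14 * y 2 - b * y 4) * e 7"
    "row 4 = y 0 * e 5 + (b * y 3 - b14 * y 1) * e 7"
    "row 5 = y 0 * e 6 - b * y 2 * e 7"
    "row 6 = y 0 * e 7 + b * y 1 * e 7"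
    "row 7 = 0"
    unfolding row_def sum_0_to_7
    by (simp_all add: mu7_table_def del: One_nat_def) (simp_all add: algebra_simps)
  show ?thesis
    unfolding row_def[symmetric] sum_0_to_7 rows by algebra
qed

lemma mult_eq_iff_eq_divide:
  fixes x y z d D :: "'a::field"
  assumes "D = z * d" "z \<noteq> 0" "d \<noteq> 0"
  shows "x * D = z * y \<longleftrightarrow> x = y / d"
  using assms by (simp add: field_simps)

text \<open>\<open>D\<close> is the coefficient of the new seventh basis vector along
  \<open>e 7\<close>. The left side is what comparing \<open>e 7\<close> coefficients produces;
  cancelling \<open>B1\<close>, \<open>A0\<close>, \<open>A0^3\<close> or \<open>A0^5 * B1\<close>
  against \<open>D\<close> gives the quotients.\<close>

lemma basis_change_equations:
  fixes A0 A1 B1 b :: complex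
  defines "D \<equiv> A0 ^ 5 * B1 * (A0 + A1 * b)"
  assumes "A0 \<noteq> 0" "B1 \<noteq> 0" "A0 + A1 * b \<noteq> 0"
  shows "x00 * D = y00 \<and> x01 * D = B1 * y01 \<and> x11 * D = B1^2 * y11 \<and> x12 * D = A0 * y12 \<and>
      x14 * D = A0^3 * y14 \<and> x * D = A0^5 * B1^2 * y \<longleftrightarrow>
    x00 = y00 / (A0^5 * B1 * (A0 + A1 * b)) \<and>
    x01 = y01 / (A0^5 * (A0 + A1 * b)) \<and>
    x11 = B1 * y11 / (A0^5 * (A0 + A1 * b)) \<and>
    x12 = y12 / (A0^4 * B1 * (A0 + A1 * b)) \<and>
    x14 = y14 / (A0^2 * B1 * (A0 + A1 * b)) \<and>
    x = B1 * y / (A0 + A1 * b)"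
proof -
  have "x00 * D = y00 \<longleftrightarrow> x00 = y00 / (A0^5 * B1 * (A0 + A1 * b))"
    using mult_eq_iff_eq_divide[of D 1 D x00 y00] assms by simp
  moreover have "x01 * D = B1 * y01 \<longleftrightarrow> x01 = y01 / (A0^5 * (A0 + A1 * b))"
    by (rule mult_eq_iff_eq_divide) (use assms in simp_all)
  moreover have "x11 * D = B1 * (B1 * y11) \<longleftrightarrow> x11 = B1 * y11 / (A0^5 * (A0 + A1 * b))"
    by (rule mult_eq_iff_eq_divide) (use assms in simp_all)
  moreover have "x12 * D = A0 * y12 \<longleftrightarrow> x12 = y12 / (A0^4 * B1 * (A0 + A1 * b))"
    by (rule mult_eq_iff_eq_divide) (use assms in \<open>simp_all add: eval_nat_numeral\<close>)
  moreover have "x14 * D = A0^3 * y14 \<longleftrightarrow> x14 = y14 / (A0^2 * B1 * (A0 + A1 * b))"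
    by (rule mult_eq_iff_eq_divide) (use assms in \<open>simp_all add: eval_nat_numeral\<close>)
  moreover have "x * D = (A0^5 * B1) * (B1 * y) \<longleftrightarrow> x = B1 * y / (A0 + A1 * b)"
    by (rule mult_eq_iff_eq_divide) (use assms in simp_all)
  ultimately show ?thesis
    by (simp add: power2_eq_square mult.assoc)
qed

section \<open>Coordinates with respect to an adapted basis\<close>

locale mu7_algebra = leibniz_algebra scale bracket
  for scale :: "complex \<Rightarrow> 'a::ab_group_add \<Rightarrow> 'a" and bracket +
  fixes b00 b01 b11 b12 b14 b :: complex and e :: "nat \<Rightarrow> 'a"
  assumes adapted: "adapted_basis scale bracket b00 b01 b11 b12 b14 b e"
begin

lemma inj_e: "inj_on e {0..7}"
  and independent_e: "independent (e ` {0..7})"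
  and span_e: "span (e ` {0..7}) = UNIV"
  and bracket_e: "i \<le> 7 \<Longrightarrow> j \<le> 7 \<Longrightarrow>
    bracket (e i) (e j) = mu7_table scale e b00 b01 b11 b12 b14 b i j"
  using adapted by (auto simp: adapted_basis_def)

text \<open>The coordinate functionals dual to \<open>e\<close>; only \<open>k \<le> 7\<close> is
  meaningful.\<close>

definition coord :: "nat \<Rightarrow> 'a \<Rightarrow> complex" where
  "coord k x = representation (e ` {0..7}) x (e k)"

lemma linear_coord: "Vector_Spaces.linear scale (*) (coord k)"
proof -
  interpret cc: vector_space "(*) :: complex \<Rightarrow> complex \<Rightarrow> complex"
    by standard (auto simp: algebra_simps)
  show ?thesis
    by unfold_locales
      (auto simp: coord_def representation_add representation_scale independent_e span_e)
qed

lemma coord_add: "coord k (x + y) = coord k x + coord k y"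
  and coord_scale: "coord k (scale c x) = c * coord k x"
  and coord_diff: "coord k (x - y) = coord k x - coord k y"
  and coord_neg: "coord k (- x) = - coord k x"
  and coord_zero: "coord k 0 = 0"
  and coord_sum: "coord k (sum f A) = (\<Sum>i\<in>A. coord k (f i))"
proof -
  interpret f: Vector_Spaces.linear scale "(*)" "coord k"
    by (rule linear_coord)
  show "coord k (x + y) = coord k x + coord k y" "coord k (scale c x) = c * coord k x"
    "coord k (x - y) = coord k x - coord k y" "coord k (- x) = - coord k x" "coord k 0 = 0"
    "coord k (sum f A) = (\<Sum>i\<in>A. coord k (f i))"
    by (rule f.add f.scale f.diff f.neg f.zero f.sum)+
qed

sublocale left: Vector_Spaces.linear scale scale "\<lambda>x. bracket x y" for y
  by (rule linear_bracket_left)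

sublocale right: Vector_Spaces.linear scale scale "\<lambda>y. bracket x y" for x
  by (rule linear_bracket_right)

lemma coord_e:
  assumes "i \<le> 7" "k \<le> 7"
  shows "coord k (e i) = (if i = k then 1 else 0)"
proof -
  have "representation (e ` {0..7}) (e i) = (\<lambda>v. if v = e i then 1 else 0)"
    by (rule representation_basis) (use assms independent_e in auto)
  then show ?thesis
    using inj_onD[OF inj_e, of i k] assms by (auto simp: coord_def)
qed

lemma expand_e: "x = (\<Sum>i\<in>{0..7}. scale (coord i x) (e i))"
proof -
  have "(\<Sum>v\<in>e ` {0..7}. scale (representation (e ` {0..7}) x v) v) = x"
    by (rule sum_representation_eq) (auto simp: independent_e span_e)
  then show ?thesis
    by (simp add: sum.reindex inj_e coord_def)
qed

lemma coord_eqI: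
  assumes "\<And>k. k \<le> 7 \<Longrightarrow> coord k x = coord k y"
  shows "x = y"
proof -
  have "(\<Sum>i\<in>{0..7}. scale (coord i x) (e i)) = (\<Sum>i\<in>{0..7}. scale (coord i y) (e i))"
    by (rule sum.cong) (simp_all add: assms)
  then show ?thesis
    by (simp only: expand_e[symmetric])
qed

lemma coord_bracket:
  "coord k (bracket x y) = (\<Sum>i\<in>{0..7}. coord i x * (\<Sum>j\<in>{0..7}. coord j y *
     mu7_table (*) (\<lambda>n. coord k (e n)) b00 b01 b11 b12 b14 b i j))"
proof -
  have "bracket x y =
    (\<Sum>i\<in>{0..7}. \<Sum>j\<in>{0..7}. scale (coord i x) (scale (coord j y) (bracket (e i) (e j))))"
    by (subst expand_e[of x], subst expand_e[of y],
        simp add: left.sum right.sum left.scale right.scale scale_sum_right,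
        subst sum.swap, simp add: mult.commute)
  then have "coord k (bracket x y) =
    (\<Sum>i\<in>{0..7}. \<Sum>j\<in>{0..7}. coord i x * (coord j y * coord k (bracket (e i) (e j))))"
    by (simp only: coord_sum coord_scale)
  also have "\<dots> = (\<Sum>i\<in>{0..7}. \<Sum>j\<in>{0..7}. coord i x * (coord j y *
      mu7_table (*) (\<lambda>n. coord k (e n)) b00 b01 b11 b12 b14 b i j))"
    by (intro sum.cong refl) (simp add: bracket_e linear_mu7_table[OF linear_coord])
  finally show ?thesis
    by (simp only: sum_distrib_left)
qed

text \<open>The parameters enter only along \<open>e 7\<close>. Modulo \<open>e 7\<close> the only
  nonzero products involve \<open>e 0\<close>, which shifts the other basis vectors by one
  place.\<close>

lemma coord_bracket_low:
  assumes "k \<le> 6"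
  shows "coord k (bracket x y) =
    (if k \<le> 1 then 0 else coord (k - 1) x * coord 0 y - coord 0 x * coord (k - 1) y)"
proof -
  from assms have "k = 0 \<or> k = 1 \<or> k = 2 \<or> k = 3 \<or> k = 4 \<or> k = 5 \<or> k = 6"
    by linarith
  then show ?thesis
    unfolding coord_bracket mu7_table_bilinear_sum
    by (elim disjE) (simp_all add: coord_e)
qed

lemma coord_bracket_7:
  "coord 7 (bracket x y) = coord 6 x * coord 0 y - coord 0 x * coord 6 y
     + b00 * coord 0 x * coord 0 y + b01 * coord 0 x * coord 1 y + b11 * coord 1 x * coord 1 y
     + b12 * (coord 1 x * coord 2 y - coord 2 x * coord 1 y)
     + b14 * (coord 1 x * coord 4 y - coord 4 x * coord 1 y
              - coord 2 x * coord 3 y + coord 3 x * coord 2 y)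
     - b * (coord 1 x * coord 6 y - coord 6 x * coord 1 y
            - coord 2 x * coord 5 y + coord 5 x * coord 2 y
            + coord 3 x * coord 4 y - coord 4 x * coord 3 y)"
  unfolding coord_bracket mu7_table_bilinear_sum
  by (simp add: coord_e)

text \<open>The antisymmetric part of the table cancels, which leaves the terms in
  \<open>b00\<close>, \<open>b01\<close> and \<open>b11\<close>. This recovers a bracket with
  \<open>u 0\<close> on the left from the one with \<open>u 0\<close> on the right.\<close>

lemma bracket_add_swap:
  "bracket x y + bracket y x =
    scale (2 * b00 * coord 0 x * coord 0 y + b01 * (coord 0 x * coord 1 y + coord 1 x * coord 0 y)
      + 2 * b11 * coord 1 x * coord 1 y) (e 7)" (is "?l = ?r")
proof (rule coord_eqI)
  fix k :: nat assume "k \<le> 7"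
  then consider "k \<le> 6" | "k = 7" by linarith
  then show "coord k ?l = coord k ?r"
  proof cases
    case 1
    then show ?thesis
      by (simp add: coord_add coord_scale coord_e coord_bracket_low)
  next
    case 2
    have "coord 7 (e 7) = 1" by (simp add: coord_e)
    then show ?thesis
      unfolding 2 coord_add coord_scale coord_bracket_7 by algebra
  qed
qed

lemma bracket_self:
  "bracket x x = scale (b00 * (coord 0 x)^2 + b01 * coord 0 x * coord 1 x + b11 * (coord 1 x)^2)
    (e 7)" (is "?l = ?r")
proof (rule coord_eqI)
  fix k :: nat assume "k \<le> 7"
  then consider "k \<le> 6" | "k = 7" by linarith
  then show "coord k ?l = coord k ?r"
  proof cases
    case 1
    then show ?thesis
      by (simp add: coord_scale coord_e coord_bracket_low)
  next
    case 2
    have "coord 7 (e 7) = 1" by (simp add: coord_e)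
    then show ?thesis
      unfolding 2 coord_scale coord_bracket_7 by algebra
  qed
qed

lemma bracket_central:
  assumes "coord 0 x = 0" "coord 0 y = 0"
  shows "bracket x y = scale (coord 7 (bracket x y)) (e 7)" (is "?l = ?r")
proof (rule coord_eqI)
  fix k :: nat assume "k \<le> 7"
  then consider "k \<le> 6" | "k = 7" by linarith
  then show "coord k ?l = coord k ?r"
    by cases (simp_all add: assms coord_scale coord_e coord_bracket_low)
qed

lemma e_7_bracket: "bracket (e 7) x = 0"
  and bracket_e_7: "bracket x (e 7) = 0"
proof -
  have "coord k (bracket (e 7) x) = 0 \<and> coord k (bracket x (e 7)) = 0" if "k \<le> 7" for k
  proof (cases "k = 7")
    case True
    then show ?thesis by (simp add: coord_bracket_7 coord_e)
  next
    case False
    then have "k \<le> 6" "k - 1 \<noteq> 7" using that by linarith+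
    then show ?thesis by (simp add: coord_bracket_low coord_e)
  qed
  then show "bracket (e 7) x = 0" "bracket x (e 7) = 0"
    by (auto intro!: coord_eqI simp: coord_zero)
qed

text \<open>In a vanishing combination, coordinate \<open>i\<close> sees only \<open>u i\<close>:
  the earlier coefficients are zero by induction, and the later vectors have no such
  coordinate.\<close>

lemma triangular_basis:
  assumes low: "\<And>i k. i \<le> 7 \<Longrightarrow> k < i \<Longrightarrow> coord k (u i) = 0"
    and diag: "\<And>i. i \<le> 7 \<Longrightarrow> coord i (u i) \<noteq> 0"
  shows "inj_on u {0..7}" "independent (u ` {0..7})" "span (u ` {0..7}) = UNIV"
proof -
  show inj: "inj_on u {0..7}"
  proof (rule linorder_inj_onI)
    fix i j :: nat assume "i < j" "i \<in> {0..7}" "j \<in> {0..7}"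
    then show "u i \<noteq> u j" using low[of j i] diag[of i] by auto
  qed auto
  show indep: "independent (u ` {0..7})"
  proof
    assume "dependent (u ` {0..7})"
    then obtain c where c: "\<exists>v\<in>u ` {0..7}. c v \<noteq> 0" "(\<Sum>v\<in>u ` {0..7}. scale (c v) v) = 0"
      by (auto simp: dependent_finite)
    have "c (u i) = 0" if "i \<le> 7" for i
      using that
    proof (induction i rule: less_induct)
      case (less i)
      have "0 = coord i (\<Sum>j\<in>{0..7}. scale (c (u j)) (u j))"
        using c(2) inj by (simp add: sum.reindex coord_zero)
      also have "\<dots> = (\<Sum>j\<in>{0..7}. c (u j) * coord i (u j))"
        by (simp add: coord_sum coord_scale)
      also have "\<dots> = (\<Sum>j\<in>{i}. c (u j) * coord i (u j))"
      proof (rule sum.mono_neutral_right)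
        show "\<forall>j\<in>{0..7} - {i}. c (u j) * coord i (u j) = 0"
        proof
          fix j assume "j \<in> {0..7} - {i}"
          then consider "j < i" | "i < j" "j \<le> 7" by force
          then show "c (u j) * coord i (u j) = 0"
            by cases (use less low in auto)
        qed
      qed (use less in auto)
      finally show ?case
        using diag less.prems by simp
    qed
    then show False using c(1) by auto
  qed
  \<comment> \<open>Dimension count: eight independent vectors in a space of dimension eight span
    it.\<close>
  interpret finite_dimensional_vector_space scale "e ` {0..7}"
    by unfold_locales (auto simp: independent_e span_e)
  have "UNIV \<subseteq> span (u ` {0..7})"
    by (rule card_ge_dim_independent) (use indep inj inj_e in \<open>auto simp: card_image dimension_def\<close>)
  then show "span (u ` {0..7}) = UNIV" by auto
qed

section \<open>Chains generated by \<open>u 0\<close> and \<open>u 1\<close>\<close>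

text \<open>On vectors without \<open>e 0\<close> component, bracketing with \<open>u 0\<close> on
  the right is, modulo \<open>e 7\<close>, the shift by one place times
  \<open>coord 0 (u 0)\<close>; this is iterated \<open>i - 1\<close> times.\<close>

lemma chain_coord:
  fixes u :: "nat \<Rightarrow> 'a"
  assumes step: "\<And>i. 1 \<le> i \<Longrightarrow> i \<le> 6 \<Longrightarrow> u (i + 1) = bracket (u i) (u 0)"
    and coord_0: "coord 0 (u 1) = 0"
    and "1 \<le> i" "i \<le> 7" "k \<le> 6"
  shows "coord k (u i) = (if k < i then 0 else coord 0 (u 0) ^ (i - 1) * coord (k + 1 - i) (u 1))"
  using assms(3-)
proof (induction i arbitrary: k rule: dec_induct)
  case base
  then show ?case using coord_0 by simp
next
  case (step i)
  have "u (Suc i) = bracket (u i) (u 0)"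
    using assms(1)[of i] step by simp
  then have "coord k (u (Suc i)) = (if k \<le> 1 then 0 else coord (k - 1) (u i) * coord 0 (u 0))"
    using step.IH[of 0] step by (simp add: coord_bracket_low)
  also have "\<dots> = (if k < Suc i then 0 else coord 0 (u 0) ^ i * coord (k - i) (u 1))"
    using step.IH[of "k - 1"] step by (cases i) auto
  finally show ?case using step by simp
qed

text \<open>Modulo \<open>e 7\<close>, \<open>u 6\<close> is a multiple of \<open>e 6\<close>. The
  last factor comes from \<open>[e 6, e 0] = e 7\<close> and
  \<open>[e 6, e 1] = b e 7\<close>.\<close>

lemma chain_7:
  fixes u :: "nat \<Rightarrow> 'a"
  assumes step: "\<And>i. 1 \<le> i \<Longrightarrow> i \<le> 6 \<Longrightarrow> u (i + 1) = bracket (u i) (u 0)"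
    and coord_0: "coord 0 (u 1) = 0"
  shows "u 7 = scale (coord 0 (u 0) ^ 5 * coord 1 (u 1) *
    (coord 0 (u 0) + coord 1 (u 0) * b)) (e 7)" (is "u 7 = ?r")
proof (rule coord_eqI)
  have c: "coord k (u i) = (if k < i then 0 else coord 0 (u 0) ^ (i - 1) * coord (k + 1 - i) (u 1))"
    if "2 \<le> i" "i \<le> 7" "k \<le> 6" for i k
    using chain_coord[OF assms] that by simp
  fix k :: nat assume "k \<le> 7"
  then consider "k \<le> 6" | "k = 7" by linarith
  then show "coord k (u 7) = coord k ?r"
  proof cases
    case 1
    then show ?thesis by (simp add: c coord_scale coord_e)
  next
    case 2
    have "u 7 = bracket (u 6) (u 0)"
      using step[of 6] by simp
    then show ?thesis
      unfolding 2
      by (simp add: c coord_bracket_7 coord_scale coord_e del: One_nat_def)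
        (simp add: algebra_simps)
  qed
qed

text \<open>The entries (0,0), (0,1), (1,1), (1,2), (1,4) and (1,6) give the six equations. The
  remaining entries then follow from the chain, the antisymmetry and the alternating form of the
  \<open>e 7\<close> coordinate.\<close>

lemma chain_table_iff:
  fixes u :: "nat \<Rightarrow> 'a" and b00' b01' b11' b12' b14' b' :: complex
  assumes step: "\<And>i. 1 \<le> i \<Longrightarrow> i \<le> 6 \<Longrightarrow> u (i + 1) = bracket (u i) (u 0)"
    and coord_0: "coord 0 (u 1) = 0"
  defines "A0 \<equiv> coord 0 (u 0)" and "A1 \<equiv> coord 1 (u 0)" and "B \<equiv> \<lambda>i. coord i (u 1)"
  defines "D \<equiv> A0 ^ 5 * B 1 * (A0 + A1 * b)"
  shows "(\<forall>i\<in>{0..7}. \<forall>j\<in>{0..7}.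
      bracket (u i) (u j) = mu7_table scale u b00' b01' b11' b12' b14' b' i j) \<longleftrightarrow>
    b00' * D = A0^2 * b00 + A0 * A1 * b01 + A1^2 * b11 \<and>
    b01' * D = B 1 * (A0 * b01 + 2 * A1 * b11) \<and>
    b11' * D = (B 1)^2 * b11 \<and>
    b12' * D = A0 * ((B 1)^2 * b12 + (2 * B 1 * B 3 - (B 2)^2) * b14
      + (2 * B 2 * B 4 - 2 * B 1 * B 5 - (B 3)^2) * b) \<and>
    b14' * D = A0^3 * ((B 1)^2 * b14 + (- 2 * B 1 * B 3 + (B 2)^2) * b) \<and>
    b' * D = A0^5 * (B 1)^2 * b" (is "?table \<longleftrightarrow> ?eqs")
proof
  have c: "coord k (u i) = (if k < i then 0 else A0 ^ (i - 1) * B (k + 1 - i))"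
    if "1 \<le> i" "i \<le> 7" "k \<le> 6" for i k
    unfolding A0_def B_def by (rule chain_coord[OF step coord_0]) (use that in auto)
  have u7: "u 7 = scale D (e 7)"
    unfolding D_def A0_def A1_def B_def by (rule chain_7[OF step coord_0])
  note a = A0_def[symmetric] A1_def[symmetric]
  have c7: "coord 7 (u 7) = D"
    by (simp add: u7 coord_scale coord_e)
  have u2: "u 2 = bracket (u 1) (u 0)"
    using step[of 1] by (simp add: numeral_2_eq_2)
  \<comment> \<open>Index arithmetic can produce \<open>Suc 0\<close>; this rule and the removal of
    \<open>One_nat_def\<close> keep the index \<open>1\<close> in one form.\<close>
  have B_Suc_0: "B (Suc 0) = B 1" by simp
  note eval = B_Suc_0 mu7_table_def coord_bracket_7 c c7 a
    coord_add coord_scale coord_diff coord_neg coord_zero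
  {
    assume ?table
    then have t: "coord 7 (bracket (u i) (u j)) =
        coord 7 (mu7_table scale u b00' b01' b11' b12' b14' b' i j)"
      if "i \<le> 7" "j \<le> 7" for i j
      using that by simp
    have "b00' * D = A0^2 * b00 + A0 * A1 * b01 + A1^2 * b11"
      using t[of 0 0] by (simp add: eval power2_eq_square algebra_simps del: One_nat_def)
    moreover have "b01' * D = B 1 * (A0 * b01 + 2 * A1 * b11)"
      using t[of 0 1] by (simp add: eval u2 algebra_simps del: One_nat_def)
    moreover have "b11' * D = (B 1)^2 * b11"
      using t[of 1 1] by (simp add: eval power2_eq_square algebra_simps del: One_nat_def)
    moreover have "b12' * D = A0 * ((B 1)^2 * b12 + (2 * B 1 * B 3 - (B 2)^2) * b14
      + (2 * B 2 * B 4 - 2 * B 1 * B 5 - (B 3)^2) * b)"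
      using t[of 1 2] by (simp add: eval power2_eq_square algebra_simps del: One_nat_def)
    moreover have "b14' * D = A0^3 * ((B 1)^2 * b14 + (- 2 * B 1 * B 3 + (B 2)^2) * b)"
      using t[of 1 4] by (simp add: eval power2_eq_square algebra_simps del: One_nat_def)
    moreover have "b' * D = A0^5 * (B 1)^2 * b"
      using t[of 1 6] by (simp add: eval power2_eq_square algebra_simps del: One_nat_def)
    ultimately show ?eqs by blast
  }
  assume eqs: ?eqs
  \<comment> \<open>Replacing each basis vector by \<open>1\<close> makes the table scalar. The
    first two parameters are set to \<open>0\<close> because they occur only in row 0; the explicit
    index sets let the claim split into 49 polynomial identities.\<close>
  have coord_7: "\<forall>i\<in>{1, 2, 3, 4, 5, 6, 7}. \<forall>j\<in>{1, 2, 3, 4, 5, 6, 7}.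
    coord 7 (bracket (u i) (u j)) = mu7_table (*) (\<lambda>_. 1) 0 0 ((B 1)^2 * b11)
      (A0 * ((B 1)^2 * b12 + (2 * B 1 * B 3 - (B 2)^2) * b14
        + (2 * B 2 * B 4 - 2 * B 1 * B 5 - (B 3)^2) * b))
      (A0^3 * ((B 1)^2 * b14 + (- 2 * B 1 * B 3 + (B 2)^2) * b))
      (A0^5 * (B 1)^2 * b) i j"
    by (simp only: ball_simps(5,7) simp_thms, intro conjI;
        simp add: eval del: One_nat_def; algebra)
  have central: "bracket (u i) (u j) = mu7_table scale u b00' b01' b11' b12' b14' b' i j"
    if pos: "1 \<le> i" "i \<le> 7" "1 \<le> j" "j \<le> 7" for i j
  proof -
    have ij: "i \<in> {1, 2, 3, 4, 5, 6, 7}" "j \<in> {1, 2, 3, 4, 5, 6, 7}"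
      using pos by auto
    \<comment> \<open>Away from row and column 0 the table is homogeneous linear in the parameters,
      so \<open>D\<close> factors out and is absorbed into \<open>u 7\<close>.\<close>
    have "mu7_table (*) (\<lambda>_. 1) 0 0 (b11' * D) (b12' * D) (b14' * D) (b' * D) i j =
        D * mu7_table (*) (\<lambda>_. 1) b00' b01' b11' b12' b14' b' i j"
      using pos by (simp add: mu7_table_def)
    then have "coord 7 (bracket (u i) (u j)) =
        D * mu7_table (*) (\<lambda>_. 1) b00' b01' b11' b12' b14' b' i j"
      using eqs by (simp only: coord_7[rule_format, OF ij])
    moreover have "bracket (u i) (u j) = scale (coord 7 (bracket (u i) (u j))) (e 7)"
      by (rule bracket_central) (use pos in \<open>simp_all add: c\<close>)
    ultimately have "bracket (u i) (u j) =
        scale (mu7_table (*) (\<lambda>_. 1) b00' b01' b11' b12' b14' b' i j) (u 7)"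
      by (simp add: u7 mult.commute)
    also have "\<dots> = mu7_table scale u b00' b01' b11' b12' b14' b' i j"
      using pos by (simp add: mu7_table_def)
    finally show ?thesis .
  qed
  show ?table
  proof (intro ballI)
    fix i j :: nat assume ij: "i \<in> {0..7}" "j \<in> {0..7}"
    then have "i = 0 \<and> j = 0 \<or> i = 0 \<and> j = 1 \<or> i = 0 \<and> 2 \<le> j \<and> j \<le> 6 \<or> i = 0 \<and> j = 7
      \<or> j = 0 \<and> 1 \<le> i \<and> i \<le> 6 \<or> j = 0 \<and> i = 7 \<or> 1 \<le> i \<and> i \<le> 7 \<and> 1 \<le> j \<and> j \<le> 7"
      unfolding atLeastAtMost_iff by arith
    then consider "i = 0" "j = 0" | "i = 0" "j = 1" | "i = 0" "2 \<le> j" "j \<le> 6" | "i = 0" "j = 7"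
      | "j = 0" "1 \<le> i" "i \<le> 6" | "j = 0" "i = 7" | "1 \<le> i" "i \<le> 7" "1 \<le> j" "j \<le> 7"
      by blast
    then show "bracket (u i) (u j) = mu7_table scale u b00' b01' b11' b12' b14' b' i j"
    proof cases
      case 1
      have "bracket (u 0) (u 0) = scale (A0^2 * b00 + A0 * A1 * b01 + A1^2 * b11) (e 7)"
        unfolding bracket_self a by (simp add: mult.commute)
      then show ?thesis
        using 1 eqs by (simp add: mu7_table_def u7)
    next
      case 2
      \<comment> \<open>The bracket in the other order is \<open>u 2\<close>, so the symmetric part
        determines \<open>[u 0, u 1]\<close>.\<close>
      have swap: "bracket (u 0) (u 1) + u 2 = scale (B 1 * (A0 * b01 + 2 * A1 * b11)) (e 7)"
        unfolding u2 bracket_add_swap a coord_0 by (simp add: B_def algebra_simps)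
      have "bracket (u 0) (u 1) = - u 2 + scale (B 1 * (A0 * b01 + 2 * A1 * b11)) (e 7)"
        unfolding swap[symmetric] by simp
      then show ?thesis
        using 2 eqs by (simp add: mu7_table_def u7)
    next
      case 3
      \<comment> \<open>For \<open>j \<ge> 2\<close> the vector \<open>u j\<close> has no component
        along \<open>e 0\<close> or \<open>e 1\<close>, so the symmetric part vanishes.\<close>
      have "bracket (u 0) (u j) + bracket (u j) (u 0) = 0"
        unfolding bracket_add_swap using 3 by (simp add: c)
      then show ?thesis
        using 3 step[of j] by (simp add: mu7_table_def add_eq_0_iff2)
    next
      case 4
      then show ?thesis by (simp add: u7 right.scale bracket_e_7 mu7_table_def)
    next
      case 5
      then show ?thesis using step[of i] by (simp add: mu7_table_def)
    next
      case 6
      then show ?thesis by (simp add: u7 left.scale e_7_bracket mu7_table_def)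
    next
      case 7
      then show ?thesis by (rule central)
    qed
  qed
qed

lemma coord_sum_e: "k \<le> 7 \<Longrightarrow> coord k (\<Sum>i\<in>{0..7}. scale (c i) (e i)) = c k"
  by (simp add: coord_sum coord_scale coord_e if_distrib[of "(*) _"] cong: if_cong)

section \<open>The first generator has no \<open>e 0\<close> component\<close>

text \<open>Each bracket with \<open>u 0\<close> adds one to the number of leading zero coordinates.
  The count starts at \<open>u 2\<close>, since \<open>u 1\<close> may still have an
  \<open>e 0\<close> component; the last bound means \<open>k < m + (i - 2)\<close>.\<close>

lemma chain_coord_zero:
  fixes u :: "nat \<Rightarrow> 'a"
  assumes step: "\<And>i. 1 \<le> i \<Longrightarrow> i \<le> 6 \<Longrightarrow> u (i + 1) = bracket (u i) (u 0)"
    and m: "1 \<le> m" "\<And>k. k < m \<Longrightarrow> coord k (u 2) = 0"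
    and "2 \<le> i" "i \<le> 7" "k \<le> 6" "k + 2 < m + i"
  shows "coord k (u i) = 0"
  using assms(4-)
proof (induction i arbitrary: k rule: dec_induct)
  case base
  then show ?case using m by simp
next
  case (step i)
  have "u (Suc i) = bracket (u i) (u 0)"
    using assms(1)[of i] step by simp
  moreover have "coord 0 (u i) = 0"
    by (rule step.IH) (use step m in auto)
  moreover have "coord (k - 1) (u i) = 0" if "1 < k"
    by (rule step.IH) (use step that in auto)
  ultimately show ?case
    using step by (simp add: coord_bracket_low)
qed

text \<open>The table makes \<open>[u 1, u 2]\<close> a multiple of \<open>u 7\<close>, whose third
  coordinate is zero. That coordinate of the bracket is also minus the product of
  \<open>coord 0 (u 1)\<close> and \<open>coord 2 (u 2)\<close>, so the second factor has to be
  shown nonzero.\<close>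

lemma adapted_coord_0:
  assumes u: "adapted_basis scale bracket b00' b01' b11' b12' b14' b' u"
  shows "u 7 \<noteq> 0" "coord 0 (u 1) = 0"
proof -
  have indep: "independent (u ` {0..7})"
    and table: "\<And>i j. i \<le> 7 \<Longrightarrow> j \<le> 7 \<Longrightarrow>
      bracket (u i) (u j) = mu7_table scale u b00' b01' b11' b12' b14' b' i j"
    using u by (auto simp: adapted_basis_def)
  show u7: "u 7 \<noteq> 0"
    using indep dependent_zero[of "u ` {0..7}"] by force
  have step: "u (i + 1) = bracket (u i) (u 0)" if "1 \<le> i" "i \<le> 6" for i
    using table[of i 0] that by (simp add: mu7_table_def)
  have u2: "u 2 = bracket (u 1) (u 0)"
    using step[of 1] by (simp add: numeral_2_eq_2)
  have low: "coord k (u 2) = 0" if "k < 2" for k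
    unfolding u2 using that by (simp add: coord_bracket_low)
  have "coord 2 (u 2) \<noteq> 0"
  proof
    \<comment> \<open>Then the chain starts one place too late: \<open>u 6\<close> is a multiple of
      the central \<open>e 7\<close>, which forces \<open>u 7 = 0\<close>.\<close>
    assume "coord 2 (u 2) = 0"
    then have "coord k (u 2) = 0" if "k < 3" for k
      using low that by (cases "k = 2") auto
    then have zero: "coord k (u i) = 0" if "2 \<le> i" "i \<le> 7" "k \<le> 6" "k \<le> i" for i k
      using chain_coord_zero[OF step, of 3 i k] that by simp
    have "u 7 = bracket (u 6) (u 0)"
      using step[of 6] by simp
    then have "coord 7 (u 7) = 0"
      by (simp add: coord_bracket_7 zero)
    then have "coord k (u 7) = 0" if "k \<le> 7" for k
      using zero[of 7 k] that by (cases "k = 7") auto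
    then have "u 7 = 0"
      by (intro coord_eqI) (simp add: coord_zero)
    with u7 show False ..
  qed
  moreover have "coord 3 (bracket (u 1) (u 2)) = 0"
    using table[of 1 2] chain_coord_zero[OF step, of 2 7 3] low
    by (simp add: mu7_table_def coord_scale)
  ultimately show "coord 0 (u 1) = 0"
    using low[of 0] by (simp add: coord_bracket_low)
qed

section \<open>Parameters of all adapted bases of one algebra\<close>

lemma adapted_basis_change:
  "(\<exists>u. adapted_basis scale bracket b00' b01' b11' b12' b14' b' u) \<longleftrightarrow>
    (\<exists>A0 A1 B1 B2 B3 B4 B5 :: complex.
       A0 * B1 * (A0 + A1 * b) \<noteq> 0 \<and>
       b00' = (A0^2 * b00 + A0 * A1 * b01 + A1^2 * b11) / (A0^5 * B1 * (A0 + A1 * b)) \<and>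
       b01' = (A0 * b01 + 2 * A1 * b11) / (A0^5 * (A0 + A1 * b)) \<and>
       b11' = (B1 * b11) / (A0^5 * (A0 + A1 * b)) \<and>
       b12' = (B1^2 * b12 + (2 * B1 * B3 - B2^2) * b14
                 + (2 * B2 * B4 - 2 * B1 * B5 - B3^2) * b) / (A0^4 * B1 * (A0 + A1 * b)) \<and>
       b14' = (B1^2 * b14 + (- 2 * B1 * B3 + B2^2) * b) / (A0^2 * B1 * (A0 + A1 * b)) \<and>
       b' = (B1 * b) / (A0 + A1 * b))"
  (is "?basis \<longleftrightarrow> (\<exists>A0 A1 B1 B2 B3 B4 B5. ?change A0 A1 B1 B2 B3 B4 B5)")
proof
  assume ?basis
  then obtain u where u: "adapted_basis scale bracket b00' b01' b11' b12' b14' b' u" ..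
  then have table: "\<forall>i\<in>{0..7}. \<forall>j\<in>{0..7}.
      bracket (u i) (u j) = mu7_table scale u b00' b01' b11' b12' b14' b' i j"
    by (simp add: adapted_basis_def)
  have step: "u (i + 1) = bracket (u i) (u 0)" if "1 \<le> i" "i \<le> 6" for i
    using table[rule_format, of i 0] that by (simp add: mu7_table_def)
  note c0 = adapted_coord_0(2)[OF u]
  \<comment> \<open>This product is the coefficient of the nonzero vector \<open>u 7\<close> along
    \<open>e 7\<close>, which yields all three nonvanishing conditions at once.\<close>
  have "coord 0 (u 0) ^ 5 * coord 1 (u 1) * (coord 0 (u 0) + coord 1 (u 0) * b) \<noteq> 0"
    using chain_7[OF step c0] adapted_coord_0(1)[OF u] by fastforce
  then have nonzero: "coord 0 (u 0) \<noteq> 0" "coord 1 (u 1) \<noteq> 0"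
      "coord 0 (u 0) + coord 1 (u 0) * b \<noteq> 0"
    by auto
  have "?change (coord 0 (u 0)) (coord 1 (u 0)) (coord 1 (u 1)) (coord 2 (u 1)) (coord 3 (u 1))
      (coord 4 (u 1)) (coord 5 (u 1))"
    using basis_change_equations[OF nonzero, THEN iffD1,
        OF chain_table_iff[OF step c0, THEN iffD1, OF _ _ table]] nonzero
    by (simp only: mult_eq_0_iff de_Morgan_disj simp_thms)
  then show "\<exists>A0 A1 B1 B2 B3 B4 B5. ?change A0 A1 B1 B2 B3 B4 B5" by blast
next
  assume "\<exists>A0 A1 B1 B2 B3 B4 B5. ?change A0 A1 B1 B2 B3 B4 B5"
  then obtain A0 A1 B1 B2 B3 B4 B5 where change: "?change A0 A1 B1 B2 B3 B4 B5" by blast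
  define x0 where "x0 = scale A0 (e 0) + scale A1 (e 1)"
  define x1 where "x1 = scale B1 (e 1) + scale B2 (e 2) + scale B3 (e 3) + scale B4 (e 4)
    + scale B5 (e 5)"
  \<comment> \<open>The two generators are the prescribed combinations. The exponent
    \<open>i - 1\<close> makes \<open>u 1\<close> the zeroth iterate, so the chain rule holds from
    index 1 on.\<close>
  define u where "u i = (if i = 0 then x0 else ((\<lambda>x. bracket x x0) ^^ (i - 1)) x1)" for i :: nat
  have u0: "u 0 = x0" and u1: "u 1 = x1"
    by (simp_all add: u_def)
  have step: "u (i + 1) = bracket (u i) (u 0)" if "1 \<le> i" for i
    using that by (cases i) (auto simp: u_def)
  have coords: "coord 0 (u 0) = A0" "coord 1 (u 0) = A1" "coord 0 (u 1) = 0" "coord 1 (u 1) = B1"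
      "coord 2 (u 1) = B2" "coord 3 (u 1) = B3" "coord 4 (u 1) = B4" "coord 5 (u 1) = B5"
    unfolding u0 u1 x0_def x1_def by (simp_all add: coord_add coord_scale coord_e)
  note nonzero = change[THEN conjunct1, simplified]
  have low: "coord k (u i) = (if k < i then 0 else A0 ^ (i - 1) * coord (k + 1 - i) (u 1))"
    if "1 \<le> i" "i \<le> 7" "k \<le> 6" for i k
    unfolding coords(1)[symmetric] by (rule chain_coord[OF step coords(3)]) (use that in auto)
  have u7: "u 7 = scale (A0 ^ 5 * B1 * (A0 + A1 * b)) (e 7)"
    using chain_7[OF step coords(3)] unfolding coords by blast
  have "coord k (u i) = 0" if "i \<le> 7" "k < i" for i k
    by (subst low) (use that in auto)
  moreover have "coord i (u i) \<noteq> 0" if "i \<le> 7" for i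
  proof -
    \<comment> \<open>The diagonal entries are \<open>A0\<close>, then
      \<open>A0 ^ (i - 1) * B1\<close> for \<open>1 \<le> i \<le> 6\<close>, and finally the
      coefficient of \<open>u 7\<close>.\<close>
    consider "i = 0" | "1 \<le> i" "i \<le> 6" | "i = 7" using \<open>i \<le> 7\<close> by linarith
    then show ?thesis
    proof cases
      case 1
      then show ?thesis using nonzero coords by simp
    next
      case 2
      then show ?thesis by (subst low) (use coords nonzero in auto)
    next
      case 3
      then show ?thesis using nonzero by (simp add: u7 coord_scale coord_e)
    qed
  qed
  ultimately have "inj_on u {0..7}" "independent (u ` {0..7})" "span (u ` {0..7}) = UNIV"
    using triangular_basis by blast+
  moreover have "\<forall>i\<in>{0..7}. \<forall>j\<in>{0..7}.
      bracket (u i) (u j) = mu7_table scale u b00' b01' b11' b12' b14' b' i j"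
  proof -
    have "A0 \<noteq> 0" "B1 \<noteq> 0" "A0 + A1 * b \<noteq> 0" using nonzero by auto
    note eqs = basis_change_equations[OF this]
    show ?thesis
      by (rule iffD2[OF chain_table_iff], erule step, rule coords(3), unfold coords,
          rule iffD2[OF eqs], rule change[THEN conjunct2])
  qed
  ultimately show ?basis
    unfolding adapted_basis_def by blast
qed

end

section \<open>Isomorphisms and adapted bases\<close>

lemma leibniz_isomorphic_sym:
  assumes "leibniz_isomorphic s1 br1 s2 br2"
  shows "leibniz_isomorphic s2 br2 s1 br1"
proof -
  from assms obtain f where f: "Vector_Spaces.linear s1 s2 f" "bij f"
      "\<And>x y. f (br1 x y) = br2 (f x) (f y)"
    by (auto simp: leibniz_isomorphic_def)
  interpret f: Vector_Spaces.linear s1 s2 f by fact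
  have inv: "inv f (f x) = x" "f (inv f y) = y" for x y
    using f(2) by (auto simp: bij_is_inj bij_is_surj surj_f_inv_f)
  have "Vector_Spaces.linear s2 s1 (inv f)"
  proof
    show "inv f (x + y) = inv f x + inv f y" for x y
      by (metis inv f.add)
    show "inv f (s2 c x) = s1 c (inv f x)" for c x
      by (metis inv f.scale)
  qed
  moreover have "inv f (br2 x y) = br1 (inv f x) (inv f y)" for x y
    by (metis inv f(3))
  ultimately show ?thesis
    using bij_imp_bij_inv[OF f(2)] by (auto simp: leibniz_isomorphic_def)
qed

lemma adapted_basis_transport:
  assumes "leibniz_isomorphic s1 br1 s2 br2" "adapted_basis s1 br1 b00 b01 b11 b12 b14 b e"
  shows "\<exists>e'. adapted_basis s2 br2 b00 b01 b11 b12 b14 b e'"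
proof -
  from assms(1) obtain f where f: "Vector_Spaces.linear s1 s2 f" "bij f"
      "\<And>x y. f (br1 x y) = br2 (f x) (f y)"
    by (auto simp: leibniz_isomorphic_def)
  interpret f: Vector_Spaces.linear s1 s2 f by fact
  have inj: "inj f" and surj: "surj f"
    using f(2) by (auto simp: bij_is_inj bij_is_surj)
  have img: "(\<lambda>n. f (e n)) ` {0..7} = f ` e ` {0..7}"
    by auto
  have "adapted_basis s2 br2 b00 b01 b11 b12 b14 b (\<lambda>n. f (e n))"
    unfolding adapted_basis_def img
  proof (intro conjI ballI)
    show "inj_on (\<lambda>n. f (e n)) {0..7}"
      using assms(2) inj by (auto simp: adapted_basis_def inj_on_def)
    show "\<not> module.dependent s2 (f ` e ` {0..7})"
      using assms(2) inj f.dependent_inj_imageD by (auto simp: adapted_basis_def inj_on_subset)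
    show "module.span s2 (f ` e ` {0..7}) = UNIV"
      using assms(2) surj by (simp add: f.span_image adapted_basis_def)
    show "br2 (f (e i)) (f (e j)) = mu7_table s2 (\<lambda>n. f (e n)) b00 b01 b11 b12 b14 b i j"
      if "i \<in> {0..7}" "j \<in> {0..7}" for i j
      using assms(2) that by (simp add: adapted_basis_def linear_mu7_table[OF f(1), symmetric]
          flip: f(3))
  qed
  then show ?thesis by blast
qed

text \<open>The map matching coordinates is an isomorphism, because the coordinates of a bracket are
  the same functions of the parameters and of the arguments' coordinates in both algebras.\<close>

lemma adapted_bases_isomorphic:
  assumes "leibniz_algebra s1 br1" "adapted_basis s1 br1 b00 b01 b11 b12 b14 b e"
    and "leibniz_algebra s2 br2" "adapted_basis s2 br2 b00 b01 b11 b12 b14 b e'"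
  shows "leibniz_isomorphic s1 br1 s2 br2"
proof -
  interpret A: mu7_algebra s1 br1 b00 b01 b11 b12 b14 b e
    by (intro mu7_algebra.intro mu7_algebra_axioms.intro) fact+
  interpret B: mu7_algebra s2 br2 b00 b01 b11 b12 b14 b e'
    by (intro mu7_algebra.intro mu7_algebra_axioms.intro) fact+
  define f where "f x = (\<Sum>i\<in>{0..7}. s2 (A.coord i x) (e' i))" for x
  have coord_f: "B.coord k (f x) = A.coord k x" if "k \<le> 7" for k x
    unfolding f_def using that by (rule B.coord_sum_e)
  have "Vector_Spaces.linear s1 s2 f"
  proof
    show "f (x + y) = f x + f y" for x y
      by (rule B.coord_eqI) (simp add: coord_f B.coord_add A.coord_add)
    show "f (s1 c x) = s2 c (f x)" for c x
      by (rule B.coord_eqI) (simp add: coord_f B.coord_scale A.coord_scale)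
  qed
  moreover have "bij f"
  proof (rule bijI)
    show "inj f"
      by (rule injI, rule A.coord_eqI) (metis coord_f)
    show "surj f"
    proof (rule surjI)
      show "f (\<Sum>i\<in>{0..7}. s1 (B.coord i y) (e i)) = y" for y
        by (rule B.coord_eqI) (simp only: coord_f A.coord_sum_e)
    qed
  qed
  moreover have "f (br1 x y) = br2 (f x) (f y)" for x y
  proof (rule B.coord_eqI)
    fix k :: nat assume "k \<le> 7"
    then consider "k \<le> 6" | "k = 7" by linarith
    then show "B.coord k (f (br1 x y)) = B.coord k (br2 (f x) (f y))"
      by cases (simp_all add: coord_f A.coord_bracket_low B.coord_bracket_low
          A.coord_bracket_7 B.coord_bracket_7)
  qed
  ultimately show ?thesis
    by (auto simp: leibniz_isomorphic_def)
qed

theorem theorem3p4: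
  fixes scale\<^sub>1 :: "complex \<Rightarrow> 'v::ab_group_add \<Rightarrow> 'v"
    and bracket\<^sub>1 :: "'v \<Rightarrow> 'v \<Rightarrow> 'v"
    and scale\<^sub>2 :: "complex \<Rightarrow> 'w::ab_group_add \<Rightarrow> 'w"
    and bracket\<^sub>2 :: "'w \<Rightarrow> 'w \<Rightarrow> 'w"
    and b00 b01 b11 b12 b14 b b00' b01' b11' b12' b14' b' :: complex
  assumes "CE_mu7 scale\<^sub>1 bracket\<^sub>1 b00 b01 b11 b12 b14 b"
    and "CE_mu7 scale\<^sub>2 bracket\<^sub>2 b00' b01' b11' b12' b14' b'"
  shows "leibniz_isomorphic scale\<^sub>1 bracket\<^sub>1 scale\<^sub>2 bracket\<^sub>2 \<longleftrightarrow>
    (\<exists>A0 A1 B1 B2 B3 B4 B5 :: complex.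
       A0 * B1 * (A0 + A1 * b) \<noteq> 0 \<and>
       b00' = (A0^2 * b00 + A0 * A1 * b01 + A1^2 * b11) / (A0^5 * B1 * (A0 + A1 * b)) \<and>
       b01' = (A0 * b01 + 2 * A1 * b11) / (A0^5 * (A0 + A1 * b)) \<and>
       b11' = (B1 * b11) / (A0^5 * (A0 + A1 * b)) \<and>
       b12' = (B1^2 * b12 + (2 * B1 * B3 - B2^2) * b14
                 + (2 * B2 * B4 - 2 * B1 * B5 - B3^2) * b) / (A0^4 * B1 * (A0 + A1 * b)) \<and>
       b14' = (B1^2 * b14 + (- 2 * B1 * B3 + B2^2) * b) / (A0^2 * B1 * (A0 + A1 * b)) \<and>
       b' = (B1 * b) / (A0 + A1 * b))"
proof -
  obtain e where e: "leibniz_algebra scale\<^sub>1 bracket\<^sub>1"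
      "adapted_basis scale\<^sub>1 bracket\<^sub>1 b00 b01 b11 b12 b14 b e"
    using assms(1) by (auto simp: CE_mu7_def)
  obtain e' where e': "leibniz_algebra scale\<^sub>2 bracket\<^sub>2"
      "adapted_basis scale\<^sub>2 bracket\<^sub>2 b00' b01' b11' b12' b14' b' e'"
    using assms(2) by (auto simp: CE_mu7_def)
  interpret mu7_algebra scale\<^sub>1 bracket\<^sub>1 b00 b01 b11 b12 b14 b e
    by (intro mu7_algebra.intro mu7_algebra_axioms.intro) fact+
  \<comment> \<open>An isomorphism pulls \<open>e'\<close> back to the first algebra; conversely, an
    adapted basis \<open>u\<close> there is matched with \<open>e'\<close>.\<close>
  have "leibniz_isomorphic scale\<^sub>1 bracket\<^sub>1 scale\<^sub>2 bracket\<^sub>2 \<longleftrightarrow>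
      (\<exists>u. adapted_basis scale\<^sub>1 bracket\<^sub>1 b00' b01' b11' b12' b14' b' u)"
    using adapted_basis_transport[OF leibniz_isomorphic_sym e'(2)]
      adapted_bases_isomorphic[OF e(1) _ e'] by blast
  then show ?thesis
    unfolding adapted_basis_change .
qed

end
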